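(* Let $\beta_1,\beta_2>0$ be real numbers with $2\beta_1-\beta_2\geq 2\sqrt{2}\,e$. Let $p$ be an analytic function in $\mathbb{D}$ with $p(0)=1$ and $$1+\beta_1 zp'(z)+\beta_2 z^2p''(z)\prec 1+ze^z.$$ Then $p(z)\prec 1+\sinh^{-1}z$.
   Context: $\mathbb{D}=\{z\in\mathbb{C}:|z|<1\}$. For functions $f,g$ analytic in $\mathbb{D}$, $f\prec g$ ($f$ is subordinate to $g$) means there is an analytic $w:\mathbb{D}\to\mathbb{C}$ with $w(0)=0$ and $|w(z)|\leq|z|$ such that $f(z)=g(w(z))$ for all $z\in\mathbb{D}$. $\sinh^{-1}z=\log(z+\sqrt{1+z^2})$ is the principal branch of the inverse hyperbolic sine, analytic on $\mathbb{D}$ with value $0$ at $0$. *)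

theory Defs
  imports "HOL-Analysis.Analysis"
begin

text \<open>
  The functions \<open>f\<close> and \<open>g\<close> are meant to be analytic on the open unit disc; since only
  values on the disc matter, their analyticity is left to the statements using the notion.
\<close>
definition subordinate :: "(complex \<Rightarrow> complex) \<Rightarrow> (complex \<Rightarrow> complex) \<Rightarrow> bool" where
  "subordinate f g \<longleftrightarrow>
     (\<exists>w. w analytic_on ball 0 1 \<and> w 0 = 0 \<and>
          (\<forall>z\<in>ball 0 1. cmod (w z) \<le> cmod z) \<and>
          (\<forall>z\<in>ball 0 1. f z = g (w z)))"

text \<open>
  The library's complex \<^const>\<open>arsinh\<close> is the principal branch given by the principal
  logarithm and square root. On the disc the square root is applied to \<open>1 + z\<^sup>2\<close> with
  positive real part.
\<close>
lemma arsinh_complex_eq_Ln: "arsinh (z :: complex) = Ln (z + csqrt (1 + z\<^sup>2))"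
proof (cases "1 + z\<^sup>2 = 0")
  case True
  then show ?thesis by (simp add: arsinh_def add.commute)
next
  case False
  then have "csqrt (1 + z\<^sup>2) = (1 + z\<^sup>2) powr (1/2)"
    by (simp add: csqrt_exp_Ln powr_def)
  then show ?thesis by (simp add: arsinh_def add.commute)
qed

end

theory Submission
  imports Defs "HOL-Complex_Analysis.Cauchy_Integral_Formula"
begin

text \<open>
  Write \<open>q = p - 1\<close>. Dividing the subordination by \<open>z\<close> and using \<open>\<bar>w e\<^sup>w\<bar> \<le> e \<bar>z\<bar>\<close>, the derivative
  \<open>u = q'\<close> satisfies \<open>\<bar>\<beta>\<^sub>1 u + \<beta>\<^sub>2 z u'\<bar> \<le> e\<close>. Integrating \<open>(t\<^sup>a u(tz))'\<close> with \<open>a = \<beta>\<^sub>1/\<beta>\<^sub>2\<close> along the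
  ray through \<open>z\<close> gives \<open>\<bar>u\<bar> \<le> e/\<beta>\<^sub>1 \<le> 1/\<surd>2\<close>, hence \<open>\<bar>q(z)\<bar> \<le> \<bar>z\<bar>/\<surd>2\<close>. Since \<open>cosh (1/\<surd>2) \<le> \<surd>2\<close>,
  the function \<open>sinh \<circ> q\<close> is bounded by \<open>\<bar>z\<bar>\<close>, and it is the required Schwarz function.
\<close>

text \<open>In this strip \<open>cosh z\<close> has positive real part, so it is the principal
  square root of \<open>1 + (sinh z)\<^sup>2\<close>. The logarithm is then applied to
  \<open>sinh z + cosh z = exp z\<close>.\<close>

lemma arsinh_sinh_complex:
  fixes z :: complex
  assumes "\<bar>Im z\<bar> < pi / 2"
  shows "arsinh (sinh z) = z"
proof -
  have "cosh z = cos (\<i> * z)"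
    by (simp add: cosh_field_def cos_exp_eq mult.assoc[symmetric] add.commute)
  then have "Re (cosh z) = cos (Im z) * (exp (Re z) + exp (- Re z)) / 2"
    by (simp add: Re_cos)
  moreover have "cos (Im z) > 0"
    using assms by (intro cos_gt_zero_pi) auto
  ultimately have "Re (cosh z) > 0"
    by (simp only:) (intro divide_pos_pos mult_pos_pos add_pos_pos, auto)
  moreover have "1 + (sinh z)\<^sup>2 = (cosh z)\<^sup>2"
    by (simp add: cosh_square_eq add.commute)
  ultimately have "csqrt (1 + (sinh z)\<^sup>2) = cosh z"
    by (intro csqrt_unique) auto
  then have "arsinh (sinh z) = Ln (exp z)"
    by (simp add: arsinh_complex_eq_Ln sinh_plus_cosh)
  also have "\<dots> = z"
    using assms pi_gt_zero by (intro Ln_exp) linarith+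
  finally show ?thesis .
qed

text \<open>Mean value inequality on a disc: \<open>cosh\<close> is the derivative of
  \<open>sinh\<close>, and its modulus at \<open>x\<close> is at most
  \<open>cosh (Re x)\<close>.\<close>

lemma norm_sinh_le:
  fixes z :: complex
  assumes "norm z \<le> r"
  shows "norm (sinh z) \<le> cosh r * norm z"
proof -
  have "norm (sinh z - sinh 0) \<le> cosh r * norm (z - 0)"
  proof (rule field_differentiable_bound[of "cball 0 r" sinh cosh])
    fix x :: complex assume "x \<in> cball 0 r"
    then have "\<bar>Re x\<bar> \<le> \<bar>r\<bar>"
      using abs_Re_le_cmod[of x] by simp
    have "norm (exp x + exp (- x)) \<le> exp (Re x) + exp (- Re x)"
      by (rule norm_triangle_le) simp
    then have "norm (cosh x) \<le> cosh (Re x)"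
      by (simp add: cosh_field_def norm_divide)
    also have "\<dots> \<le> cosh r"
      using \<open>\<bar>Re x\<bar> \<le> \<bar>r\<bar>\<close> cosh_real_nonneg_le_iff[of "\<bar>Re x\<bar>" "\<bar>r\<bar>"] by simp
    finally show "norm (cosh x) \<le> cosh r" .
  next
    show "0 \<in> cball 0 r"
      using assms norm_ge_zero[of z] by (simp del: norm_ge_zero)
  qed (use assms in \<open>auto intro!: derivative_eq_intros\<close>)
  then show ?thesis by simp
qed

text \<open>By the double-argument formula the claim amounts to
  \<open>cosh (sqrt 2) \<le> 3\<close>, for which \<open>exp (sqrt 2) \<le> 5\<close>
  suffices.\<close>

lemma cosh_inverse_sqrt_2_le: "cosh (1 / sqrt 2) \<le> sqrt 2"
proof -
  have "sqrt 2 \<le> (3/2 :: real)"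
    by (rule real_le_lsqrt) (auto simp: power2_eq_square)
  \<comment> \<open>Squaring reduces the bound to a power of e: 2.8 cubed is 21.952, below
    25.\<close>
  have "(exp (sqrt 2))\<^sup>2 \<le> (exp (3/2))\<^sup>2"
    using \<open>sqrt 2 \<le> 3/2\<close> by (intro power_mono) auto
  also have "\<dots> = exp 1 ^ 3"
    by (simp flip: exp_of_nat_mult)
  also have "\<dots> \<le> (14/5) ^ 3"
    using e_less_272 by (intro power_mono) auto
  also have "\<dots> \<le> (5::real)\<^sup>2"
    by (simp add: power_divide)
  finally have "exp (sqrt 2) \<le> (5::real)"
    by (rule power2_le_imp_le) simp
  moreover have "exp (- sqrt 2) \<le> 1"
    by simp
  ultimately have "exp (sqrt 2) + exp (- sqrt 2) \<le> (6::real)"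
    by linarith
  then have "cosh (sqrt 2) \<le> (3::real)"
    by (simp add: cosh_field_def)
  moreover have "cosh (sqrt 2) = 2 * (cosh (1 / sqrt 2))\<^sup>2 - 1"
    using cosh_double_cosh[of "1 / sqrt 2 :: real"] by (simp add: real_div_sqrt)
  ultimately have "(cosh (1 / sqrt 2))\<^sup>2 \<le> (2::real)"
    by linarith
  then show ?thesis
    by (rule real_le_rsqrt)
qed

lemma radial_in_ball:
  fixes z :: complex
  assumes "z \<in> ball 0 r" "0 \<le> t" "t \<le> 1"
  shows "of_real t * z \<in> ball 0 r"
  using assms mult_right_mono[of t 1 "norm z"] by (simp add: norm_mult)

text \<open>A free \<open>S\<close> gives both two-sided derivatives at interior \<open>t\<close>
  and continuity within \<open>{0..1}\<close> up to the endpoints.\<close>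

lemma has_vector_derivative_radial:
  fixes f :: "complex \<Rightarrow> complex"
  assumes "f holomorphic_on ball 0 r" "z \<in> ball 0 r" "0 \<le> t" "t \<le> 1"
  shows "((\<lambda>t. f (of_real t * z)) has_vector_derivative z * deriv f (of_real t * z)) (at t within S)"
proof -
  have "(f has_field_derivative deriv f (of_real t * z)) (at (of_real t * z))"
    using assms(1) radial_in_ball[OF assms(2-)] by (intro holomorphic_derivI) auto
  moreover have "((\<lambda>t. of_real t * z) has_vector_derivative z) (at t)"
    by (auto intro!: derivative_eq_intros simp: has_vector_derivative_def scaleR_conv_of_real)
  ultimately show ?thesis
    using field_vector_diff_chain_at[of "\<lambda>t. of_real t * z" z t f]
    by (auto simp: o_def intro: has_vector_derivative_at_within)
qed

text \<open>The integrating factor \<open>t powr a\<close> with \<open>a = b / c\<close> turns the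
  first-order expression into a derivative along the ray. The origin is left out of
  \<open>bound\<close> because in the application the expression arises by division by
  \<open>x\<close>.\<close>

lemma norm_le_of_first_order_bound:
  fixes u :: "complex \<Rightarrow> complex" and b c M :: real
  assumes hol: "u holomorphic_on ball 0 1" and "b > 0" "c > 0" and z: "z \<in> ball 0 1" "z \<noteq> 0"
    and bound: "\<And>x. x \<in> ball 0 1 \<Longrightarrow> x \<noteq> 0 \<Longrightarrow>
      norm (of_real b * u x + of_real c * x * deriv u x) \<le> M"
  shows "norm (u z) \<le> M / b"
proof -
  define a where "a = b / c"
  have "a > 0" using assms by (simp add: a_def)
  note ball = radial_in_ball[OF z(1)]
  note ray = has_vector_derivative_radial[OF hol z(1)]
  \<comment> \<open>The comparison function is \<open>M / b * t powr a\<close>. Both sides vanish at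
    0, and \<open>a > 0\<close> makes them continuous there.\<close>
  have "norm ((1 powr a) *\<^sub>R u (of_real 1 * z) - (0 powr a) *\<^sub>R u (of_real 0 * z))
        \<le> M / b * 1 powr a - M / b * 0 powr a"
  proof (rule differentiable_bound_general)
    fix t :: real assume t: "0 < t" "t < 1"
    have powr: "((\<lambda>t. t powr a) has_real_derivative a * t powr (a - 1)) (at t)"
      using t by (intro has_real_derivative_powr) auto
    show "((\<lambda>t. (t powr a) *\<^sub>R u (of_real t * z)) has_vector_derivative
        (t powr a) *\<^sub>R (z * deriv u (of_real t * z)) + (a * t powr (a - 1)) *\<^sub>R u (of_real t * z)) (at t)"
      using t by (intro has_vector_derivative_scaleR powr ray) auto
    show "((\<lambda>t. M / b * t powr a) has_vector_derivative M / b * (a * t powr (a - 1))) (at t)"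
      using DERIV_cmult[OF powr, of "M / b"]
      unfolding has_real_derivative_iff_has_vector_derivative .
    \<comment> \<open>Factoring out \<open>t powr (a - 1) / c\<close> exposes the bounded expression
      at the point \<open>of_real t * z\<close>.\<close>
    have "t powr a = t * t powr (a - 1)"
      using t by (simp add: powr_diff)
    then have "(t powr a) *\<^sub>R (z * deriv u (of_real t * z)) + (a * t powr (a - 1)) *\<^sub>R u (of_real t * z)
        = of_real (t powr (a - 1) / c) *
          (of_real b * u (of_real t * z) + of_real c * (of_real t * z) * deriv u (of_real t * z))"
      using \<open>c > 0\<close> by (simp add: a_def scaleR_conv_of_real field_simps)
    also have "norm \<dots> \<le> t powr (a - 1) / c * M"
      unfolding norm_mult norm_of_real
      using bound[of "of_real t * z"] ball[of t] t z \<open>c > 0\<close>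
      by (intro mult_mono) auto
    also have "\<dots> = M / b * (a * t powr (a - 1))"
      using \<open>b > 0\<close> by (simp add: a_def)
    finally show "norm ((t powr a) *\<^sub>R (z * deriv u (of_real t * z)) +
        (a * t powr (a - 1)) *\<^sub>R u (of_real t * z)) \<le> M / b * (a * t powr (a - 1))" .
  next
    have "continuous_on {0..1} (\<lambda>t. u (of_real t * z))"
      unfolding continuous_on_eq_continuous_within
      using ray has_vector_derivative_continuous by fastforce
    moreover have powr: "continuous_on {0..1} (\<lambda>t::real. t powr a)"
      using \<open>a > 0\<close> by (intro continuous_on_powr') auto
    ultimately show "continuous_on {0..1} (\<lambda>t. (t powr a) *\<^sub>R u (of_real t * z))"
      by (intro continuous_on_scaleR)
    show "continuous_on {0..1} (\<lambda>t::real. M / b * t powr a)"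
      by (intro continuous_intros powr)
  qed auto
  then show ?thesis by simp
qed

text \<open>Along the ray only \<open>0 < t < 1\<close> matters for the derivative, so no bound at
  the origin is required.\<close>

lemma norm_diff_le_of_deriv_bound:
  fixes f :: "complex \<Rightarrow> complex"
  assumes hol: "f holomorphic_on ball 0 1" and z: "z \<in> ball 0 1"
    and bound: "\<And>x. x \<in> ball 0 1 \<Longrightarrow> x \<noteq> 0 \<Longrightarrow> norm (deriv f x) \<le> K"
  shows "norm (f z - f 0) \<le> K * norm z"
proof (cases "z = 0")
  case False
  note ball = radial_in_ball[OF z]
  note ray = has_vector_derivative_radial[OF hol z]
  have "norm (f (of_real 1 * z) - f (of_real 0 * z)) \<le> (K * norm z) * 1 - (K * norm z) * 0"
  proof (rule differentiable_bound_general)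
    show "continuous_on {0..1} (\<lambda>t. f (of_real t * z))"
      unfolding continuous_on_eq_continuous_within
      using ray has_vector_derivative_continuous by fastforce
    fix t :: real assume t: "0 < t" "t < 1"
    then show "((\<lambda>t. f (of_real t * z)) has_vector_derivative z * deriv f (of_real t * z)) (at t)"
      by (intro ray) auto
    show "((*) (K * norm z) has_vector_derivative K * norm z) (at t)"
      by (auto intro!: derivative_eq_intros simp: has_vector_derivative_def)
    show "norm (z * deriv f (of_real t * z)) \<le> K * norm z"
      using bound[of "of_real t * z"] ball[of t] t False
      by (simp add: norm_mult mult.commute mult_right_mono)
  qed (auto intro!: continuous_intros)
  then show ?thesis by simp
qed simp

theorem theorem3p6:
  fixes \<beta>\<^sub>1 \<beta>\<^sub>2 :: real and p :: "complex \<Rightarrow> complex"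
  assumes "\<beta>\<^sub>1 > 0" and "\<beta>\<^sub>2 > 0"
    and "2 * \<beta>\<^sub>1 - \<beta>\<^sub>2 \<ge> 2 * sqrt 2 * exp 1"
    and "p analytic_on ball 0 1" and "p 0 = 1"
    and "subordinate
           (\<lambda>z. 1 + of_real \<beta>\<^sub>1 * z * deriv p z + of_real \<beta>\<^sub>2 * z\<^sup>2 * deriv (deriv p) z)
           (\<lambda>z. 1 + z * exp z)"
  shows "subordinate p (\<lambda>z. 1 + arsinh z)"
proof -
  have hol: "p holomorphic_on ball 0 1"
    using assms(4) by (rule analytic_imp_holomorphic)
  then have hol': "deriv p holomorphic_on ball 0 1"
    by (intro holomorphic_deriv) auto
  obtain w where w: "\<And>z. z \<in> ball 0 1 \<Longrightarrow> norm (w z) \<le> norm z"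
    and eq: "\<And>z. z \<in> ball 0 1 \<Longrightarrow>
      of_real \<beta>\<^sub>1 * z * deriv p z + of_real \<beta>\<^sub>2 * z\<^sup>2 * deriv (deriv p) z = w z * exp (w z)"
    using assms(6) unfolding subordinate_def add.assoc add_left_cancel by blast
  \<comment> \<open>Cancel one factor \<open>z\<close>: the exponential of \<open>w z\<close> has
    modulus \<open>exp (Re (w z)) \<le> exp 1\<close>, and \<open>w z\<close> itself supplies the
    factor \<open>norm z\<close>.\<close>
  have rhs: "norm (of_real \<beta>\<^sub>1 * deriv p z + of_real \<beta>\<^sub>2 * z * deriv (deriv p) z) \<le> exp 1"
    if z: "z \<in> ball 0 1" "z \<noteq> 0" for z
  proof -
    have "Re (w z) \<le> 1"
      using w[OF z(1)] complex_Re_le_cmod[of "w z"] z by simp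
    then have "norm (w z * exp (w z)) \<le> norm z * exp 1"
      unfolding norm_mult using w[OF z(1)] by (intro mult_mono) auto
    also have "w z * exp (w z) = z * (of_real \<beta>\<^sub>1 * deriv p z + of_real \<beta>\<^sub>2 * z * deriv (deriv p) z)"
      using eq[OF z(1)] by (simp add: algebra_simps power2_eq_square)
    finally show ?thesis
      using z(2) by (simp add: norm_mult)
  qed
  \<comment> \<open>As \<open>\<beta>\<^sub>2\<close> is positive, the hypothesis yields
    \<open>\<beta>\<^sub>1 \<ge> sqrt 2 * exp 1\<close>.\<close>
  have "exp 1 / \<beta>\<^sub>1 \<le> 1 / sqrt 2"
    using assms(1-3) by (simp add: field_simps)
  then have deriv_le: "norm (deriv p z) \<le> 1 / sqrt 2" if "z \<in> ball 0 1" "z \<noteq> 0" for z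
    using norm_le_of_first_order_bound[OF hol' assms(1,2) that rhs] by linarith
  have p_le: "norm (p z - 1) \<le> 1 / sqrt 2 * norm z" if "z \<in> ball 0 1" for z
    using norm_diff_le_of_deriv_bound[OF hol that deriv_le] assms(5) by simp
  have p_le': "norm (p z - 1) \<le> 1 / sqrt 2" if "z \<in> ball 0 1" for z
    using p_le[OF that] mult_left_mono[of "norm z" 1 "1 / sqrt 2"] that by simp
  \<comment> \<open>Solving \<open>p z = 1 + arsinh (v z)\<close> for \<open>v\<close> suggests this
    witness.\<close>
  define v where "v = (\<lambda>z. sinh (p z - 1))"
  have "v analytic_on ball 0 1"
    unfolding v_def sinh_field_def by (intro analytic_intros assms(4)) auto
  moreover have "v 0 = 0"
    by (simp add: v_def assms(5))
  moreover have "norm (v z) \<le> norm z" if z: "z \<in> ball 0 1" for z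
  proof -
    have "norm (v z) \<le> cosh (1 / sqrt 2) * norm (p z - 1)"
      unfolding v_def by (rule norm_sinh_le[OF p_le'[OF z]])
    \<comment> \<open>The bound on \<open>cosh\<close> exactly offsets the factor
      \<open>1 / sqrt 2\<close> gained for \<open>p - 1\<close>.\<close>
    also have "\<dots> \<le> sqrt 2 * (1 / sqrt 2 * norm z)"
      using cosh_inverse_sqrt_2_le p_le[OF z] by (intro mult_mono) auto
    finally show ?thesis by simp
  qed
  moreover have "p z = 1 + arsinh (v z)" if z: "z \<in> ball 0 1" for z
  proof -
    \<comment> \<open>Since 1 is below \<open>pi / 2\<close>, the values of \<open>p - 1\<close> lie
      in the strip where \<open>arsinh\<close> inverts \<open>sinh\<close>.\<close>
    have "1 / sqrt 2 \<le> (1::real)"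
      by simp
    then have "\<bar>Im (p z - 1)\<bar> < pi / 2"
      using p_le'[OF z] abs_Im_le_cmod[of "p z - 1"] pi_gt3 by linarith
    then show ?thesis
      unfolding v_def by (simp only: arsinh_sinh_complex) simp
  qed
  ultimately show ?thesis
    unfolding subordinate_def by blast
qed

end
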